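(* Consider the RoPE spherical self-attention flow on $(\mathbb{S}^{d-1})^n$, $d=2r$. The consensus manifold $$\mathcal C=\{(x^\star,\ldots,x^\star):x^\star\in\mathbb{S}^{d-1}\}$$ consists of equilibria. At such a point, with $x^\star=(x^\star_{(1)},\dots,x^\star_{(r)})$, $x^\star_{(\ell)}\in\mathbb{R}^2$, and plane energies $a_\ell=\|x^\star_{(\ell)}\|^2$ (so $a_\ell\ge0$, $\sum_\ell a_\ell=1$), the kernel $W$ takes the value $$W^\star_{ij}=\exp\bigl(\beta K_a(p_i-p_j)\bigr),\qquad K_a(h)=\sum_{\ell=1}^{r}a_\ell\cos(\omega_\ell h).$$ Thus the consensus kernel depends on $x^\star$ only through the plane-energy vector $a=(a_1,\dots,a_r)$, not through the within-plane phases.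
   Context: Let $n\ge2$ and $d=2r$ with $r\ge1$. Token $i$ has a fixed position $p_i\in\mathbb{R}$ and state $x_i\in\mathbb{S}^{d-1}$. For real frequencies $\omega_1,\dots,\omega_r$, define the block rotation $R_p=\bigoplus_{\ell=1}^r\begin{pmatrix}\cos(\omega_\ell p)&-\sin(\omega_\ell p)\\ \sin(\omega_\ell p)&\cos(\omega_\ell p)\end{pmatrix}$. For finite $\beta\ge0$: $s_{ij}(x)=\langle R_{p_i}x_i,R_{p_j}x_j\rangle$, $W_{ij}(x)=e^{\beta s_{ij}(x)}$, $Z_i(x)=\sum_kW_{ik}(x)$, $A_{ij}(x)=W_{ij}(x)/Z_i(x)$. The flow is $\dot x_i=\sum_{j=1}^nA_{ij}(x)(x_j-\langle x_i,x_j\rangle x_i)$. *)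

theory Defs
  imports "HOL-Analysis.Analysis"
begin

text \<open>The ambient space of dimension \<open>d = 2r\<close> is the orthogonal sum of \<open>r\<close> coordinate planes,
  rendered as \<open>real^2^'r\<close> with \<open>r = CARD('r)\<close>: \<open>z $ l\<close> is the component of \<open>z\<close> in plane \<open>l\<close>, and
  the library's inner product and norm on this type are the Euclidean ones.  Configurations of
  \<open>n = CARD('n)\<close> tokens are functions on the index type \<open>'n\<close>.\<close>

lemma DIM_planes: "DIM(real^2^'r::finite) = 2 * CARD('r)"
  by simp

definition rotation2 :: "real \<Rightarrow> real^2^2" where
  "rotation2 t = vector [vector [cos t, - sin t], vector [sin t, cos t]]"

definition block_rotation :: "('r::finite \<Rightarrow> real) \<Rightarrow> real^2^'r \<Rightarrow> real^2^'r" where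
  "block_rotation t z = (\<chi> l. rotation2 (t l) *v (z $ l))"

definition rope :: "('r::finite \<Rightarrow> real) \<Rightarrow> real \<Rightarrow> real^2^'r \<Rightarrow> real^2^'r" where
  "rope \<omega> q = block_rotation (\<lambda>l. \<omega> l * q)"

definition rope_score ::
  "('r::finite \<Rightarrow> real) \<Rightarrow> ('n \<Rightarrow> real) \<Rightarrow> ('n \<Rightarrow> real^2^'r) \<Rightarrow> 'n \<Rightarrow> 'n \<Rightarrow> real" where
  "rope_score \<omega> p x i j = rope \<omega> (p i) (x i) \<bullet> rope \<omega> (p j) (x j)"

definition rope_kernel ::
  "('r::finite \<Rightarrow> real) \<Rightarrow> ('n \<Rightarrow> real) \<Rightarrow> real \<Rightarrow> ('n \<Rightarrow> real^2^'r) \<Rightarrow> 'n \<Rightarrow> 'n \<Rightarrow> real" where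
  "rope_kernel \<omega> p \<beta> x i j = exp (\<beta> * rope_score \<omega> p x i j)"

definition rope_normalizer ::
  "('r::finite \<Rightarrow> real) \<Rightarrow> ('n::finite \<Rightarrow> real) \<Rightarrow> real \<Rightarrow> ('n \<Rightarrow> real^2^'r) \<Rightarrow> 'n \<Rightarrow> real" where
  "rope_normalizer \<omega> p \<beta> x i = (\<Sum>k\<in>UNIV. rope_kernel \<omega> p \<beta> x i k)"

definition rope_attention ::
  "('r::finite \<Rightarrow> real) \<Rightarrow> ('n::finite \<Rightarrow> real) \<Rightarrow> real \<Rightarrow> ('n \<Rightarrow> real^2^'r) \<Rightarrow> 'n \<Rightarrow> 'n \<Rightarrow> real" where
  "rope_attention \<omega> p \<beta> x i j = rope_kernel \<omega> p \<beta> x i j / rope_normalizer \<omega> p \<beta> x i"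

text \<open>The right-hand side of the flow \<open>dx\<^sub>i/dt = rope_field \<omega> p \<beta> x i\<close>.\<close>

definition rope_field ::
  "('r::finite \<Rightarrow> real) \<Rightarrow> ('n::finite \<Rightarrow> real) \<Rightarrow> real \<Rightarrow> ('n \<Rightarrow> real^2^'r) \<Rightarrow> 'n \<Rightarrow> real^2^'r" where
  "rope_field \<omega> p \<beta> x i =
     (\<Sum>j\<in>UNIV. rope_attention \<omega> p \<beta> x i j *\<^sub>R (x j - (x i \<bullet> x j) *\<^sub>R x i))"

definition rope_equilibria ::
  "('r::finite \<Rightarrow> real) \<Rightarrow> ('n::finite \<Rightarrow> real) \<Rightarrow> real \<Rightarrow> ('n \<Rightarrow> real^2^'r) set" where
  "rope_equilibria \<omega> p \<beta> =
     {x. (\<forall>i. x i \<in> sphere 0 1) \<and> (\<forall>i. rope_field \<omega> p \<beta> x i = 0)}"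

definition consensus :: "real^2^'r::finite \<Rightarrow> 'n \<Rightarrow> real^2^'r" where
  "consensus z = (\<lambda>i. z)"

definition consensus_manifold :: "('n \<Rightarrow> real^2^'r::finite) set" where
  "consensus_manifold = consensus ` sphere 0 1"

definition plane_energy :: "real^2^'r::finite \<Rightarrow> 'r \<Rightarrow> real" where
  "plane_energy z l = (norm (z $ l))\<^sup>2"

definition consensus_profile :: "('r::finite \<Rightarrow> real) \<Rightarrow> ('r \<Rightarrow> real) \<Rightarrow> real \<Rightarrow> real" where
  "consensus_profile \<omega> a h = (\<Sum>l\<in>UNIV. a l * cos (\<omega> l * h))"

end

theory Submission
  imports Defs
begin

text \<open>At consensus every token carries the same vector \<open>z\<close>, so the score of tokens \<open>i\<close> and \<open>j\<close> is
  the inner product of two rotated copies of one vector. In each plane, two copies of \<open>u\<close> rotated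
  by \<open>s\<close> and \<open>t\<close> enclose the angle \<open>s - t\<close>, so their inner product is the squared length of \<open>u\<close>
  times \<open>cos (s - t)\<close> (\<open>inner_rotation2_same\<close>): the direction of \<open>u\<close> drops out. Summing over the
  planes gives the closed form of the score (\<open>rope_score_consensus\<close>), in which \<open>z\<close> appears only
  through its plane energies. Invariance under phase shifts follows because rotating within the
  planes preserves these energies (\<open>plane_energy_block_rotation\<close>).

  Equilibrium has a separate cause: each summand of the field is an attention weight
  times the projection of one token onto the tangent space at another, and the projection of \<open>z\<close>
  onto the tangent space at \<open>z\<close> itself is zero, whatever the weights are.\<close>

text \<open>For \<open>u = (a, b)\<close> the mixed terms \<open>a b sin (s - t)\<close> occur with both signs and cancel because
  the two vectors being rotated coincide; for linearly independent vectors the term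
  \<open>det (u, v) sin (s - t)\<close> would survive.\<close>

lemma inner_rotation2_same:
  "(rotation2 s *v u) \<bullet> (rotation2 t *v u) = (norm u)\<^sup>2 * cos (s - t)"
proof -
  have "(norm u)\<^sup>2 = u $ 1 * u $ 1 + u $ 2 * u $ 2"
    by (simp add: power2_norm_eq_inner inner_vec_def sum_2)
  then show ?thesis
    by (simp add: rotation2_def matrix_vector_mult_def inner_vec_def sum_2 cos_diff)
      (simp add: algebra_simps)
qed

lemma inner_block_rotation_same:
  "block_rotation s z \<bullet> block_rotation t z = (\<Sum>l\<in>UNIV. plane_energy z l * cos (s l - t l))"
  by (simp add: block_rotation_def inner_vec_def [of "\<chi> l. _ l"] inner_rotation2_same
      plane_energy_def)

text \<open>Two equal rotation angles differ by zero, so \<open>inner_rotation2_same\<close> with \<open>s = t\<close> says that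
  a plane rotation is an isometry.\<close>

lemma plane_energy_block_rotation:
  "plane_energy (block_rotation \<phi> z) = plane_energy z"
  by (simp only: fun_eq_iff plane_energy_def block_rotation_def inner_rotation2_same vec_lambda_beta
      diff_self cos_zero mult_1_right power2_norm_eq_inner simp_thms)

lemma sum_plane_energy: "(\<Sum>l\<in>UNIV. plane_energy z l) = (norm z)\<^sup>2"
  by (simp only: plane_energy_def power2_norm_eq_inner inner_vec_def [of z z])

lemma rope_score_consensus:
  "rope_score \<omega> p (consensus z) i j = consensus_profile \<omega> (plane_energy z) (p i - p j)"
  by (simp add: rope_score_def rope_def consensus_def consensus_profile_def
      inner_block_rotation_same right_diff_distrib)

lemma rope_kernel_consensus:
  "rope_kernel \<omega> p \<beta> (consensus z) i j
     = exp (\<beta> * consensus_profile \<omega> (plane_energy z) (p i - p j))"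
  by (simp add: rope_kernel_def rope_score_consensus)

lemma rope_kernel_consensus_cong:
  assumes "plane_energy z = plane_energy w"
  shows "rope_kernel \<omega> p \<beta> (consensus z) = rope_kernel \<omega> p \<beta> (consensus w)"
  by (intro ext) (simp add: rope_kernel_consensus assms)

lemma consensus_manifold_subset_equilibria:
  "consensus_manifold \<subseteq> rope_equilibria \<omega> p \<beta>"
proof -
  have "consensus z \<in> rope_equilibria \<omega> p \<beta>" if "norm z = 1" for z
  proof -
    have "z \<bullet> z = 1"
      using that by (simp add: norm_eq_1)
    with that show ?thesis
      by (simp add: rope_equilibria_def rope_field_def consensus_def)
  qed
  then show ?thesis
    by (auto simp: consensus_manifold_def)
qed

theorem proposition4p1:
  fixes \<omega> :: "'r::finite \<Rightarrow> real" and p :: "'n::finite \<Rightarrow> real" and \<beta> :: real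
  assumes "CARD('n) \<ge> 2" and "\<beta> \<ge> 0"
  shows "(consensus_manifold :: ('n \<Rightarrow> real^2^'r) set) \<subseteq> rope_equilibria \<omega> p \<beta>
    \<and> (\<forall>z \<in> (sphere 0 1 :: (real^2^'r) set).
          (\<forall>l. plane_energy z l \<ge> 0)
        \<and> (\<Sum>l\<in>UNIV. plane_energy z l) = 1
        \<and> (\<forall>i j. rope_kernel \<omega> p \<beta> (consensus z) i j
                 = exp (\<beta> * consensus_profile \<omega> (plane_energy z) (p i - p j))))
    \<and> (\<forall>z \<in> (sphere 0 1 :: (real^2^'r) set). \<forall>w \<in> sphere 0 1.
          plane_energy z = plane_energy w \<longrightarrow>
          rope_kernel \<omega> p \<beta> (consensus z) = rope_kernel \<omega> p \<beta> (consensus w))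
    \<and> (\<forall>z \<in> (sphere 0 1 :: (real^2^'r) set). \<forall>\<phi> :: 'r \<Rightarrow> real.
          rope_kernel \<omega> p \<beta> (consensus (block_rotation \<phi> z)) = rope_kernel \<omega> p \<beta> (consensus z))"
proof (intro conjI ballI allI impI)
  show "(consensus_manifold :: ('n \<Rightarrow> real^2^'r) set) \<subseteq> rope_equilibria \<omega> p \<beta>"
    by (rule consensus_manifold_subset_equilibria)
next
  fix z :: "real^2^'r" and l
  show "plane_energy z l \<ge> 0"
    by (simp add: plane_energy_def)
next
  fix z :: "real^2^'r"
  assume "z \<in> sphere 0 1"
  then show "(\<Sum>l\<in>UNIV. plane_energy z l) = 1"
    by (simp add: sum_plane_energy)
next
  fix z :: "real^2^'r" and i j
  show "rope_kernel \<omega> p \<beta> (consensus z) i j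
          = exp (\<beta> * consensus_profile \<omega> (plane_energy z) (p i - p j))"
    by (rule rope_kernel_consensus)
next
  fix z w :: "real^2^'r"
  assume "plane_energy z = plane_energy w"
  then show "rope_kernel \<omega> p \<beta> (consensus z) = rope_kernel \<omega> p \<beta> (consensus w)"
    by (rule rope_kernel_consensus_cong)
next
  fix z :: "real^2^'r" and \<phi>
  show "rope_kernel \<omega> p \<beta> (consensus (block_rotation \<phi> z)) = rope_kernel \<omega> p \<beta> (consensus z)"
    by (rule rope_kernel_consensus_cong [OF plane_energy_block_rotation])
qed

end
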